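(* There exists an absolute constant $C>0$ (independent of $N$ and $W$) such that the following holds. Let $N\geq 2$ be an integer, let $W$ be a real number with $\frac{1}{2N}<W<\frac12$, and set $K:=\lfloor 2NW\rfloor$. Then $$\left\Vert \frac{1}{K}\rho_K(N,W;\cdot)-\frac{1}{2W}\mathbf{1}_{[-W,W]}\right\Vert_{L^1(I)}\leq C\,\frac{\log N}{K},$$ where $I=[-1/2,1/2]$, $\rho_K(N,W;\xi)=\sum_{k=0}^{K-1}|U_k(N,W;\xi)|^2$, and $U_k(N,W;\cdot)$, $0\le k\le N-1$, are the discrete prolate spheroidal (Slepian) functions with parameters $N,W$.
   Context: Let $I=[-1/2,1/2]$ with Lebesgue measure. For an integer $N\ge 2$ let $\mathbf{D}_N(x)=\frac{\sin(N\pi x)}{\sin(\pi x)}$ be the Dirichlet kernel (extended by continuity at the integers), and let $\mathcal{P}_N\subseteq L^2(I)$ be the $N$-dimensional span of the exponentials $x\mapsto e^{2\pi i x(\frac{-N+1}{2}+j)}$, $0\le j\le N-1$; it is a Hilbert space with reproducing kernel $\mathbf{D}_N(x-y)$. Let $P_{\mathcal{P}_N}$ be the orthogonal projection of $L^2(I)$ onto $\mathcal{P}_N$, and define the Toeplitz operator $H_W^N f=P_{\mathcal{P}_N}\big((P_{\mathcal{P}_N}f)\cdot \mathbf{1}_{[-W,W]}\big)$, $f\in L^2(I)$. The Slepian functions $U_k(N,W;\cdot)$, $k=0,\dots,N-1$, are the eigenfunctions of $H_W^N$ in $\mathcal{P}_N$, forming an orthonormal basis of $\mathcal{P}_N$ (in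 particular $\int_I|U_k(N,W;\xi)|^2\,d\xi=1$), with corresponding eigenvalues ordered non-increasingly $\lambda_0(N,W)\ge\lambda_1(N,W)\ge\dots\ge\lambda_{N-1}(N,W)$. Equivalently, $\int_{-W}^{W}\mathbf{D}_N(\xi-\xi')U_k(N,W;\xi')\,d\xi'=\lambda_k(N,W)U_k(N,W;\xi)$. *)

theory Defs
  imports "HOL-Analysis.Analysis"
begin

definition unit_interval :: "real set" where
  "unit_interval = {-1/2..1/2}"

definition L2_inner :: "(real \<Rightarrow> complex) \<Rightarrow> (real \<Rightarrow> complex) \<Rightarrow> complex" where
  "L2_inner f g = set_lebesgue_integral lebesgue unit_interval (\<lambda>x. f x * cnj (g x))"

text \<open>As a Bochner integral this is the usual norm only for integrable \<open>f\<close>; it is applied below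
  to a trigonometric polynomial minus a multiple of an indicator function.\<close>

definition L1_norm :: "(real \<Rightarrow> real) \<Rightarrow> real" where
  "L1_norm f = set_lebesgue_integral lebesgue unit_interval (\<lambda>x. \<bar>f x\<bar>)"

definition complex_span :: "nat \<Rightarrow> (nat \<Rightarrow> real \<Rightarrow> complex) \<Rightarrow> (real \<Rightarrow> complex) set" where
  "complex_span n b = {f. \<exists>c :: nat \<Rightarrow> complex. f = (\<lambda>x. \<Sum>j<n. c j * b j x)}"

definition trig_exp :: "nat \<Rightarrow> nat \<Rightarrow> real \<Rightarrow> complex" where
  "trig_exp N j x =
     exp (2 * complex_of_real pi * \<i> * complex_of_real (x * ((- real N + 1) / 2 + real j)))"

definition trig_space :: "nat \<Rightarrow> (real \<Rightarrow> complex) set" where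
  "trig_space N = complex_span N (trig_exp N)"

text \<open>The description is unique on genuine functions, not only up to null sets, because elements of
  \<open>trig_space N\<close> are determined on all of \<open>\<real>\<close> by their restriction to \<open>unit_interval\<close>.\<close>

definition trig_proj :: "nat \<Rightarrow> (real \<Rightarrow> complex) \<Rightarrow> real \<Rightarrow> complex" where
  "trig_proj N f =
     (THE g. g \<in> trig_space N \<and> (\<forall>h\<in>trig_space N. L2_inner (\<lambda>x. f x - g x) h = 0))"

definition toeplitz_op :: "nat \<Rightarrow> real \<Rightarrow> (real \<Rightarrow> complex) \<Rightarrow> real \<Rightarrow> complex" where
  "toeplitz_op N W f = trig_proj N (\<lambda>x. trig_proj N f x * indicator {-W..W} x)"

text \<open>Slepian functions are only determined up to unimodular factors, so they are given by a
  predicate on a family \<open>U\<close> together with its eigenvalues \<open>ev\<close>; only indices below \<open>N\<close> matter.\<close>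

definition slepian_system ::
    "nat \<Rightarrow> real \<Rightarrow> (nat \<Rightarrow> real \<Rightarrow> complex) \<Rightarrow> (nat \<Rightarrow> real) \<Rightarrow> bool" where
  "slepian_system N W U ev \<longleftrightarrow>
     complex_span N U = trig_space N \<and>
     (\<forall>j<N. \<forall>k<N. L2_inner (U j) (U k) = (if j = k then 1 else 0)) \<and>
     (\<forall>k<N. toeplitz_op N W (U k) = (\<lambda>x. complex_of_real (ev k) * U k x)) \<and>
     (\<forall>j k. j \<le> k \<and> k < N \<longrightarrow> ev k \<le> ev j)"

definition slepian_density :: "(nat \<Rightarrow> real \<Rightarrow> complex) \<Rightarrow> nat \<Rightarrow> real \<Rightarrow> real" where
  "slepian_density U K x = (\<Sum>k<K. (cmod (U k x))\<^sup>2)"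

end

theory Submission
  imports Defs
begin

text \<open>
  Write \<open>\<rho>\<close> for the density of the first \<open>K\<close> Slepian functions and \<open>\<lambda>\<^sub>k\<close> for the eigenvalues.
  The density of all \<open>N\<close> functions is the constant \<open>N\<close>, so \<open>\<rho> \<le> N\<close>, while also
  \<open>1 / (2 W) \<le> N / K\<close>. Hence the \<open>L\<^sup>1\<close> error has a majorant whose integral only depends on how much
  of the mass of \<open>\<rho>\<close> lies in the band, and since the \<open>k\<close>th function has mass \<open>\<lambda>\<^sub>k\<close> there, the
  error is at most \<open>(4 N W - 2 \<Sum>k<K. \<lambda>\<^sub>k) / K\<close> (\<open>L1_error_le\<close>). As \<open>K\<close> is the integer part of
  \<open>2 N W\<close>, it suffices to bound \<open>\<Sum>k<K. 1 - \<lambda>\<^sub>k\<close> by a multiple of \<open>log N\<close>.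

  The eigenvalues decrease, lie in \<open>[0, 1]\<close> and sum to the trace \<open>2 N W \<ge> K\<close>. These facts alone
  show that the last sum is at most twice \<open>\<Sum>k<N. \<lambda>\<^sub>k (1 - \<lambda>\<^sub>k)\<close>
  (\<open>sum_complement_le_twice_deviation\<close>), which is a difference of traces: in the basis of
  exponentials the operator is the Toeplitz matrix of the Fourier coefficients \<open>a\<^sub>m(W)\<close> of the
  indicator of the band, so the sum equals \<open>F(W) = 2 N W - \<Sum>i,j<N. a\<^sub>i\<^sub>-\<^sub>j(W)\<^sup>2\<close>
  (\<open>sum_ev_deviation\<close>).

  The function \<open>F\<close> is controlled by two integrations. Its second derivative in \<open>W\<close> is
  \<open>-8\<close> times \<open>\<bar>\<Sum>j<N. cis (4 \<pi> W j)\<bar>\<^sup>2\<close>, a Fejer kernel, which is at most \<open>1 / (16 W\<^sup>2)\<close> for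
  \<open>W \<le> 1/4\<close>; its first derivative vanishes at \<open>1/4\<close>. So \<open>F'\<close> is at most \<open>1 / (2 W)\<close>
  before \<open>1/4\<close> and nonpositive after it. With \<open>F \<le> 1\<close> at \<open>W = 1 / (2 N)\<close> this gives
  \<open>F(W) \<le> 1 + (log N) / 2\<close> (\<open>band_leakage_log_bound\<close>).
\<close>

section \<open>The leakage function and the Fejer kernel\<close>

text \<open>The Fourier coefficient of the indicator of \<open>[-W, W]\<close> at frequency \<open>m\<close>.\<close>
definition band_coeff :: "int \<Rightarrow> real \<Rightarrow> real" where
  "band_coeff m W = (if m = 0 then 2 * W else sin (2 * pi * of_int m * W) / (pi * of_int m))"

lemma band_coeff_half: "band_coeff m (1/2) = (if m = 0 then 1 else 0)"
  by (simp add: band_coeff_def mult.commute sin_int_times_real)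

lemma has_real_derivative_band_coeff:
  "(band_coeff m has_real_derivative 2 * cos (2 * pi * of_int m * W)) (at W)"
proof (cases "m = 0")
  case True
  then have "band_coeff m = (\<lambda>W. 2 * W)" by (simp add: band_coeff_def fun_eq_iff)
  with True show ?thesis by (auto intro!: derivative_eq_intros)
next
  case False
  then have "band_coeff m = (\<lambda>W. sin (2 * pi * of_int m * W) / (pi * of_int m))"
    by (simp add: band_coeff_def fun_eq_iff)
  with False show ?thesis by (auto intro!: derivative_eq_intros simp: field_simps)
qed

text \<open>By the double-angle formula the derivative of a squared coefficient is again a coefficient, at
  twice the bandwidth. This makes two differentiations of the leakage below computable for all
  frequencies at once, the frequency zero included.\<close>
lemma has_real_derivative_band_coeff_sq:
  "((\<lambda>W. (band_coeff m W)\<^sup>2) has_real_derivative 2 * band_coeff m (2 * W)) (at W)"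
proof -
  have "2 * sin (2 * pi * of_int m * W) * cos (2 * pi * of_int m * W) = sin (2 * pi * of_int m * (2 * W))"
    using sin_double [of "2 * pi * of_int m * W"] by (simp add: algebra_simps)
  then have eq: "2 * band_coeff m W * (2 * cos (2 * pi * of_int m * W)) = 2 * band_coeff m (2 * W)"
    by (auto simp: band_coeff_def field_simps)
  have "((\<lambda>W. (band_coeff m W)\<^sup>2) has_real_derivative 2 * band_coeff m W * (2 * cos (2 * pi * of_int m * W))) (at W)"
    by (rule derivative_eq_intros has_real_derivative_band_coeff)+ simp
  then show ?thesis by (simp only: eq)
qed

text \<open>\<open>N\<close> times the Fejer kernel. It is left as a double sum because it arises from summing over
  the entries of a Toeplitz matrix.\<close>
definition fejer_sum :: "nat \<Rightarrow> real \<Rightarrow> real" where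
  "fejer_sum N \<theta> = (\<Sum>i<N. \<Sum>j<N. cos ((real i - real j) * \<theta>))"

lemma fejer_sum_eq: "fejer_sum N \<theta> = (cmod (\<Sum>j<N. cis (real j * \<theta>)))\<^sup>2"
proof -
  have "complex_of_real ((cmod (\<Sum>j<N. cis (real j * \<theta>)))\<^sup>2)
     = (\<Sum>i<N. \<Sum>j<N. cis ((real i - real j) * \<theta>))"
    by (simp only: complex_norm_square cnj_sum sum_product cis_cnj cis_mult)
       (simp add: algebra_simps)
  then have "Re (complex_of_real ((cmod (\<Sum>j<N. cis (real j * \<theta>)))\<^sup>2)) = fejer_sum N \<theta>"
    by (simp add: fejer_sum_def)
  then show ?thesis by simp
qed

lemma fejer_sum_nonneg: "0 \<le> fejer_sum N \<theta>"
  by (simp add: fejer_sum_eq)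

text \<open>The geometric sum of \<open>cis \<theta> ^ j\<close> times \<open>1 - cis \<theta>\<close> telescopes to a difference of two unit
  vectors, and \<open>1 - cis \<theta>\<close> has modulus \<open>2 * \<bar>sin (\<theta>/2)\<bar>\<close>.\<close>
lemma fejer_sum_mult_sin_sq: "fejer_sum N \<theta> * (sin (\<theta>/2))\<^sup>2 \<le> 1"
proof -
  have "(1 - cis \<theta>) * (\<Sum>j<N. cis (real j * \<theta>)) = 1 - cis \<theta> ^ N"
    using one_diff_power_eq [of "cis \<theta>" N] by (simp add: Complex.DeMoivre)
  then have "cmod (1 - cis \<theta>) * cmod (\<Sum>j<N. cis (real j * \<theta>)) = cmod (1 - cis \<theta> ^ N)"
    by (metis norm_mult)
  also have "\<dots> \<le> 2"
    using norm_triangle_ineq4 [of 1 "cis \<theta> ^ N"] by (simp add: norm_power)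
  finally have "(cmod (1 - cis \<theta>) * cmod (\<Sum>j<N. cis (real j * \<theta>)))\<^sup>2 \<le> 2\<^sup>2"
    by (intro power_mono) auto
  moreover have "(cmod (1 - cis \<theta>))\<^sup>2 = 4 * (sin (\<theta>/2))\<^sup>2"
  proof -
    have "(cmod (1 - cis \<theta>))\<^sup>2 = 2 - 2 * cos \<theta>"
      by (simp add: cmod_power2 power2_diff)
    also have "\<dots> = 4 * (sin (\<theta>/2))\<^sup>2"
      using cos_double_sin [of "\<theta>/2"] by simp
    finally show ?thesis .
  qed
  ultimately show ?thesis
    by (simp add: power_mult_distrib fejer_sum_eq mult.commute)
qed

text \<open>Jordan's inequality: the sine is concave on \<open>[0, \<pi>/2]\<close>, so it lies above its chord.\<close>
lemma sin_ge_chord: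
  assumes "0 \<le> x" "x \<le> pi / 2"
  shows "2 * x / pi \<le> sin x"
proof -
  have "concave_on {0..pi/2} sin"
    by (rule f''_le0_imp_concave [where f' = cos and f'' = "\<lambda>x. - sin x"])
       (auto intro!: derivative_eq_intros sin_ge_zero)
  from concave_onD_Icc [OF this, of "2 * x / pi"] assms show ?thesis
    by (simp add: field_simps)
qed

text \<open>The trace of \<open>H - H * H\<close> for the Toeplitz matrix \<open>H\<close> with entries
  \<open>band_coeff (i - j) W\<close>; for the Slepian eigenvalues this is \<open>\<Sum>k<N. ev k * (1 - ev k)\<close>, see
  \<open>sum_ev_deviation\<close>. The second function is its derivative in \<open>W\<close>.\<close>
definition band_leakage :: "nat \<Rightarrow> real \<Rightarrow> real" where
  "band_leakage N W = 2 * real N * W - (\<Sum>i<N. \<Sum>j<N. (band_coeff (int i - int j) W)\<^sup>2)"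

definition band_leakage' :: "nat \<Rightarrow> real \<Rightarrow> real" where
  "band_leakage' N W = 2 * real N - (\<Sum>i<N. \<Sum>j<N. 2 * band_coeff (int i - int j) (2 * W))"

lemma has_real_derivative_band_leakage:
  "(band_leakage N has_real_derivative band_leakage' N W) (at W)"
  unfolding band_leakage_def band_leakage'_def
  by (rule derivative_eq_intros has_real_derivative_band_coeff_sq refl)+ simp

lemma has_real_derivative_band_leakage':
  "(band_leakage' N has_real_derivative - 8 * fejer_sum N (4 * pi * W)) (at W)"
proof -
  have *: "((\<lambda>W. band_coeff m (2 * W)) has_real_derivative 4 * cos (of_int m * (4 * pi * W))) (at W)" for m
    using DERIV_chain2 [where g = "\<lambda>W. 2 * W" and x = W and s = UNIV,
        OF has_real_derivative_band_coeff [of m] DERIV_cmult_Id]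
    by (simp add: mult_ac)
  show ?thesis
    unfolding band_leakage'_def fejer_sum_def
    by (rule derivative_eq_intros * refl)+ (simp add: sum_distrib_left sum_negf)
qed

text \<open>At \<open>W = 1/4\<close> the derivative involves \<open>band_coeff\<close> at the full bandwidth \<open>1/2\<close>, where the
  Toeplitz matrix is the identity. This gives the initial value from which the derivative is
  recovered by integrating the Fejer kernel.\<close>
lemma band_leakage'_quarter: "band_leakage' N (1/4) = 0"
  by (simp add: band_leakage'_def band_coeff_half if_distrib [of "\<lambda>x. 2 * x"] cong: if_cong)

lemma band_leakage_le: "band_leakage N W \<le> 2 * real N * W"
  by (simp add: band_leakage_def sum_nonneg)

lemma band_leakage'_nonpos:
  assumes "1/4 \<le> W"
  shows "band_leakage' N W \<le> 0"
proof -
  have "band_leakage' N W \<le> band_leakage' N (1/4)"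
    by (rule DERIV_nonpos_imp_nonincreasing [OF assms])
       (meson has_real_derivative_band_leakage' fejer_sum_nonneg mult_nonpos_nonneg neg_le_0_iff_le zero_le_numeral)
  then show ?thesis by (simp add: band_leakage'_quarter)
qed

text \<open>Up to \<open>W = 1/4\<close> the half-angle \<open>2 * pi * W\<close> stays in \<open>[0, \<pi>/2]\<close>, where Jordan's inequality
  bounds its sine below by \<open>4 * W\<close>.\<close>
lemma fejer_sum_le:
  assumes "0 < W" "W \<le> 1/4"
  shows "16 * W\<^sup>2 * fejer_sum N (4 * pi * W) \<le> 1"
proof -
  have "2 * (2 * pi * W) / pi \<le> sin (2 * pi * W)"
    by (rule sin_ge_chord) (use assms in \<open>auto simp: field_simps\<close>)
  then have "(4 * W)\<^sup>2 \<le> (sin (2 * pi * W))\<^sup>2"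
    using assms by (intro power_mono) auto
  then have "fejer_sum N (4 * pi * W) * (4 * W)\<^sup>2 \<le> fejer_sum N (4 * pi * W) * (sin (2 * pi * W))\<^sup>2"
    by (intro mult_left_mono fejer_sum_nonneg)
  also have "\<dots> \<le> 1"
    using fejer_sum_mult_sin_sq [of N "4 * pi * W"] by (simp add: mult.assoc)
  finally show ?thesis by (simp add: power_mult_distrib mult_ac)
qed

text \<open>By \<open>fejer_sum_le\<close> the second derivative of the leakage is at least \<open>- 1 / (2 * W\<^sup>2)\<close>, the
  derivative of \<open>1 / (2 * W)\<close>. Comparison backwards from \<open>W = 1/4\<close> gives the bound.\<close>
lemma band_leakage'_le:
  assumes "0 < W" "W \<le> 1/4"
  shows "band_leakage' N W \<le> 1 / (2 * W)"
proof -
  have "1 / (2 * (1/4)) - band_leakage' N (1/4) \<le> 1 / (2 * W) - band_leakage' N W"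
  proof (rule DERIV_nonpos_imp_nonincreasing [OF assms(2)])
    fix w assume w: "W \<le> w" "w \<le> 1/4"
    with assms have "0 < w" by simp
    have "((\<lambda>w. 1 / (2 * w) - band_leakage' N w) has_real_derivative
            (- 1 / (2 * w\<^sup>2) + 8 * fejer_sum N (4 * pi * w))) (at w)"
      using \<open>0 < w\<close>
      by (auto intro!: derivative_eq_intros has_real_derivative_band_leakage' simp: power2_eq_square)
    moreover have "- 1 / (2 * w\<^sup>2) + 8 * fejer_sum N (4 * pi * w) \<le> 0"
      using fejer_sum_le [of w N] w \<open>0 < w\<close> by (simp add: field_simps)
    ultimately show "\<exists>y. ((\<lambda>w. 1 / (2 * w) - band_leakage' N w) has_real_derivative y) (at w) \<and> y \<le> 0"
      by blast
  qed
  then show ?thesis by (simp add: band_leakage'_quarter)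
qed

text \<open>A second integration. Below \<open>1 / (2 * N)\<close> the bound on the derivative is useless, but there
  the trivial estimate \<open>band_leakage_le\<close> already gives at most \<open>1\<close>; from there up to \<open>1/4\<close> the
  derivative bound \<open>1 / (2 * W)\<close> contributes half a logarithm, and beyond \<open>1/4\<close> the leakage
  decreases.\<close>
lemma band_leakage_log_bound:
  assumes N: "2 \<le> N" and W: "1 / (2 * real N) \<le> W"
  shows "band_leakage N W \<le> 1 + ln (real N) / 2"
proof -
  have low: "band_leakage N w \<le> 1 + ln (real N) / 2" if w: "1 / (2 * real N) \<le> w" "w \<le> 1/4" for w
  proof -
    define W0 where "W0 = 1 / (2 * real N)"
    have W0: "0 < W0" "W0 \<le> w" using N w by (auto simp: W0_def)
    have "ln W0 / 2 - band_leakage N W0 \<le> ln w / 2 - band_leakage N w"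
    proof (rule DERIV_nonneg_imp_nondecreasing [OF W0(2)])
      fix v assume v: "W0 \<le> v" "v \<le> w"
      with W0 have "0 < v" by simp
      have "((\<lambda>v. ln v / 2 - band_leakage N v) has_real_derivative (1 / (2 * v) - band_leakage' N v)) (at v)"
        using \<open>0 < v\<close>
        by (auto intro!: derivative_eq_intros has_real_derivative_band_leakage)
      moreover have "0 \<le> 1 / (2 * v) - band_leakage' N v"
        using band_leakage'_le [of v N] v w \<open>0 < v\<close> by simp
      ultimately show "\<exists>y. ((\<lambda>v. ln v / 2 - band_leakage N v) has_real_derivative y) (at v) \<and> 0 \<le> y"
        by blast
    qed
    moreover have "band_leakage N W0 \<le> 1"
      using band_leakage_le [of N W0] N by (simp add: W0_def)
    moreover have "ln w - ln W0 \<le> ln (real N)"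
    proof -
      have "ln w - ln W0 = ln (2 * real N * w)"
        using W0 N ln_div [of w W0] by (auto simp: W0_def mult_ac)
      also have "\<dots> \<le> ln (real N)"
        using W0 N w by (subst ln_le_cancel_iff) auto
      finally show ?thesis .
    qed
    ultimately show ?thesis by linarith
  qed
  show ?thesis
  proof (cases "W \<le> 1/4")
    case False
    have "band_leakage N W \<le> band_leakage N (1/4)"
      by (rule DERIV_nonpos_imp_nonincreasing)
         (use False has_real_derivative_band_leakage band_leakage'_nonpos in \<open>auto, blast\<close>)
    also have "\<dots> \<le> 1 + ln (real N) / 2"
      by (rule low) (use N in \<open>auto simp: field_simps\<close>)
    finally show ?thesis .
  qed (use low W in blast)
qed

section \<open>Inner products over a band\<close>

text \<open>The inner product of \<open>L\<^sup>2[-W, W]\<close>; the bandwidth is a parameter so that the inner product of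
  the whole period is the case \<open>W = 1/2\<close> and needs no separate computation.\<close>
definition band_inner :: "real \<Rightarrow> (real \<Rightarrow> complex) \<Rightarrow> (real \<Rightarrow> complex) \<Rightarrow> complex" where
  "band_inner W f g = (LINT x:{-W..W}|lebesgue. f x * cnj (g x))"

lemma L2_inner_eq_band_inner: "L2_inner = band_inner (1/2)"
  by (simp add: fun_eq_iff L2_inner_def band_inner_def unit_interval_def)

lemma L2_inner_indicator:
  assumes "W \<le> 1/2"
  shows "L2_inner (\<lambda>x. f x * indicator {-W..W} x) g = band_inner W f g"
  unfolding L2_inner_def band_inner_def set_lebesgue_integral_def unit_interval_def
  by (rule Bochner_Integration.integral_cong) (use assms in \<open>auto split: split_indicator\<close>)

lemma set_integral_sum:
  fixes f :: "'i \<Rightarrow> 'a \<Rightarrow> 'b::{banach, second_countable_topology}"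
  assumes "\<And>i. i \<in> I \<Longrightarrow> set_integrable M A (f i)"
  shows "(LINT x:A|M. (\<Sum>i\<in>I. f i x)) = (\<Sum>i\<in>I. LINT x:A|M. f i x)"
  using assms unfolding set_integrable_def set_lebesgue_integral_def
  by (simp add: scaleR_sum_right)

lemma band_inner_commute: "band_inner W g f = cnj (band_inner W f g)"
  unfolding band_inner_def set_lebesgue_integral_def
  by (subst Bochner_Integration.integral_cnj [symmetric]) (simp add: mult.commute)

lemma band_inner_sum_left:
  assumes "\<And>j. j \<in> J \<Longrightarrow> continuous_on UNIV (b j)" "continuous_on UNIV g"
  shows "band_inner W (\<lambda>x. \<Sum>j\<in>J. c j * b j x) g = (\<Sum>j\<in>J. c j * band_inner W (b j) g)"
proof -
  have "band_inner W (\<lambda>x. \<Sum>j\<in>J. c j * b j x) g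
      = (LINT x:{-W..W}|lebesgue. (\<Sum>j\<in>J. c j * (b j x * cnj (g x))))"
    by (simp add: band_inner_def sum_distrib_right mult.assoc)
  also have "\<dots> = (\<Sum>j\<in>J. LINT x:{-W..W}|lebesgue. c j * (b j x * cnj (g x)))"
    using assms
    by (intro set_integral_sum absolutely_integrable_continuous_real continuous_intros)
       (auto intro: continuous_on_subset)
  finally show ?thesis by (simp add: band_inner_def)
qed

lemma band_inner_sum_right:
  assumes "\<And>j. j \<in> J \<Longrightarrow> continuous_on UNIV (b j)" "continuous_on UNIV g"
  shows "band_inner W g (\<lambda>x. \<Sum>j\<in>J. c j * b j x) = (\<Sum>j\<in>J. cnj (c j) * band_inner W g (b j))"
  using band_inner_sum_left [OF assms, where W = W and c = c]
  by (simp add: band_inner_commute [of W g])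

lemma trig_exp_mult_cnj:
  "trig_exp N i x * cnj (trig_exp N j x) = cis (2 * pi * of_int (int i - int j) * x)"
proof -
  have "trig_exp N i x = cis (2 * pi * x * ((- real N + 1) / 2 + real i))" for i
    by (simp add: trig_exp_def cis_conv_exp mult_ac)
  then show ?thesis by (simp add: cis_cnj cis_mult algebra_simps)
qed

lemma continuous_on_trig_exp [continuous_intros]: "continuous_on S (trig_exp N j)"
  unfolding trig_exp_def by (intro continuous_intros)

text \<open>For \<open>m \<noteq> 0\<close> the antiderivative is a multiple of \<open>- \<i> * cis (2 * pi * m * x)\<close>, whose
  imaginary part is even and cancels between the end points, while the odd real part, a sine,
  doubles.\<close>
lemma integral_cis_symmetric:
  assumes "0 \<le> W"
  shows "(LINT x:{-W..W}|lebesgue. cis (2 * pi * of_int m * x)) = of_real (band_coeff m W)"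
proof -
  define F where "F x = (if m = 0 then of_real x
      else cis (2 * pi * of_int m * x) / (2 * of_real pi * \<i> * of_int m))" for x :: real
  have "(F has_vector_derivative cis (2 * pi * of_int m * x)) (at x within A)" for x A
  proof (cases "m = 0")
    case True
    then show ?thesis unfolding F_def by (auto intro!: derivative_eq_intros)
  next
    case False
    then show ?thesis unfolding F_def
      by (auto intro!: derivative_eq_intros simp: has_vector_derivative_def scaleR_conv_of_real)
  qed
  then have "((\<lambda>x. cis (2 * pi * of_int m * x)) has_integral F W - F (-W)) {-W..W}"
    using assms by (intro fundamental_theorem_of_calculus) auto
  moreover have "set_integrable lebesgue {-W..W} (\<lambda>x. cis (2 * pi * of_int m * x))"
    by (intro absolutely_integrable_continuous_real continuous_intros)
  ultimately have "(LINT x:{-W..W}|lebesgue. cis (2 * pi * of_int m * x)) = F W - F (-W)"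
    by (simp add: set_lebesgue_integral_eq_integral integral_unique)
  also have "\<dots> = of_real (band_coeff m W)"
  proof (cases "m = 0")
    case False
    let ?t = "2 * pi * of_int m * W"
    have "cis ?t - cis (- ?t) = 2 * \<i> * of_real (sin ?t)"
      by (simp add: complex_eq_iff)
    moreover have "F W - F (-W) = (cis ?t - cis (- ?t)) / (2 * of_real pi * \<i> * of_int m)"
      using False by (simp add: F_def diff_divide_distrib)
    ultimately show ?thesis using False by (simp add: band_coeff_def)
  qed (simp add: F_def band_coeff_def)
  finally show ?thesis .
qed

lemma band_inner_trig_exp:
  assumes "0 \<le> W"
  shows "band_inner W (trig_exp N i) (trig_exp N j) = of_real (band_coeff (int i - int j) W)"
  unfolding band_inner_def trig_exp_mult_cnj using integral_cis_symmetric [OF assms] by blast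

lemma band_inner_trig_sum:
  assumes "0 \<le> W"
  shows "band_inner W (\<lambda>x. \<Sum>i<N. c i * trig_exp N i x) (trig_exp N j)
    = (\<Sum>i<N. c i * of_real (band_coeff (int i - int j) W))"
  by (simp add: band_inner_sum_left continuous_on_trig_exp band_inner_trig_exp [OF assms])

lemma L2_inner_trig_sum:
  assumes "j < N"
  shows "L2_inner (\<lambda>x. \<Sum>i<N. c i * trig_exp N i x) (trig_exp N j) = c j"
  using assms
  by (simp add: L2_inner_eq_band_inner band_inner_trig_sum band_coeff_half
      if_distrib [of complex_of_real] if_distrib [of "\<lambda>x. _ * x"] cong: if_cong)

section \<open>The projection and the Toeplitz operator in coordinates\<close>
lemma generator_in_complex_span:
  assumes "k < n"
  shows "b k \<in> complex_span n b"
  unfolding complex_span_def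
  by (rule CollectI, rule exI [of _ "\<lambda>i. if i = k then 1 else 0"])
     (use assms in \<open>simp add: fun_eq_iff if_distrib [of "\<lambda>x. x * _"] cong: if_cong\<close>)

text \<open>The exponentials are orthonormal, so the partial Fourier sum satisfies the defining
  orthogonality relations; testing these relations against the exponentials determines every
  coefficient, which gives uniqueness. The hypothesis is integrability rather than continuity
  because a trigonometric polynomial truncated to the band, to which this is applied, jumps.\<close>
lemma trig_proj_eq:
  assumes f: "\<And>j. j < N \<Longrightarrow> set_integrable lebesgue unit_interval (\<lambda>x. f x * cnj (trig_exp N j x))"
  shows "trig_proj N f = (\<lambda>x. \<Sum>j<N. L2_inner f (trig_exp N j) * trig_exp N j x)"
proof -
  have diff: "L2_inner (\<lambda>x. f x - (\<Sum>j<N. c j * trig_exp N j x)) (trig_exp N i)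
      = L2_inner f (trig_exp N i) - c i" if i: "i < N" for c i
  proof -
    let ?u = "\<lambda>x. \<Sum>j<N. c j * trig_exp N j x"
    have "set_integrable lebesgue unit_interval (\<lambda>x. ?u x * cnj (trig_exp N i x))"
      unfolding unit_interval_def
      by (intro absolutely_integrable_continuous_real continuous_intros)
    from set_integral_diff(2) [OF f [OF i] this]
    have "L2_inner (\<lambda>x. f x - ?u x) (trig_exp N i)
        = L2_inner f (trig_exp N i) - L2_inner ?u (trig_exp N i)"
      by (simp add: L2_inner_def left_diff_distrib)
    then show ?thesis using i by (simp add: L2_inner_trig_sum)
  qed
  show ?thesis
    unfolding trig_proj_def
  proof (rule the_equality)
    let ?g = "\<lambda>x. \<Sum>j<N. L2_inner f (trig_exp N j) * trig_exp N j x"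
    have "L2_inner (\<lambda>x. f x - ?g x) h = 0" if h_in: "h \<in> trig_space N" for h
    proof -
      obtain d where h: "h = (\<lambda>x. \<Sum>j<N. d j * trig_exp N j x)"
        using h_in unfolding trig_space_def complex_span_def by blast
      have "v * cnj (h x) = (\<Sum>j<N. cnj (d j) * (v * cnj (trig_exp N j x)))" for v x
        by (simp add: h sum_distrib_left mult_ac)
      then have "L2_inner (\<lambda>x. f x - ?g x) h
          = (LINT x:unit_interval|lebesgue. (\<Sum>j<N. cnj (d j) * ((f x - ?g x) * cnj (trig_exp N j x))))"
        by (simp only: L2_inner_def)
      also have "\<dots> = (\<Sum>j<N. cnj (d j) * L2_inner (\<lambda>x. f x - ?g x) (trig_exp N j))"
      proof (subst set_integral_sum)
        fix i assume i: "i \<in> {..<N}"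
        have "set_integrable lebesgue unit_interval (\<lambda>x. ?g x * cnj (trig_exp N i x))"
          unfolding unit_interval_def
          by (intro absolutely_integrable_continuous_real continuous_intros)
        then have "set_integrable lebesgue unit_interval (\<lambda>x. (f x - ?g x) * cnj (trig_exp N i x))"
          using set_integral_diff(1) [OF f] i by (simp add: left_diff_distrib)
        then show "set_integrable lebesgue unit_interval
            (\<lambda>x. cnj (d i) * ((f x - ?g x) * cnj (trig_exp N i x)))"
          by simp
      qed (simp add: L2_inner_def)
      also have "\<dots> = 0" by (simp add: diff)
      finally show ?thesis .
    qed
    then show "?g \<in> trig_space N \<and> (\<forall>h\<in>trig_space N. L2_inner (\<lambda>x. f x - ?g x) h = 0)"
      by (auto simp: trig_space_def complex_span_def)
  next
    fix g assume g: "g \<in> trig_space N \<and> (\<forall>h\<in>trig_space N. L2_inner (\<lambda>x. f x - g x) h = 0)"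
    then obtain c where c: "g = (\<lambda>x. \<Sum>j<N. c j * trig_exp N j x)"
      by (auto simp: trig_space_def complex_span_def)
    have "c j = L2_inner f (trig_exp N j)" if j: "j < N" for j
    proof -
      have "trig_exp N j \<in> trig_space N"
        unfolding trig_space_def using j by (rule generator_in_complex_span)
      with g have "L2_inner (\<lambda>x. f x - g x) (trig_exp N j) = 0" by blast
      with diff [OF j, of c] show ?thesis by (simp add: c)
    qed
    then show "g = (\<lambda>x. \<Sum>j<N. L2_inner f (trig_exp N j) * trig_exp N j x)"
      by (simp add: c)
  qed
qed

text \<open>In the basis of exponentials the operator is multiplication by the Toeplitz matrix of
  \<open>band_coeff\<close>.\<close>
lemma toeplitz_op_trig_sum:
  fixes c :: "nat \<Rightarrow> complex"
  assumes W: "0 \<le> W" "W \<le> 1/2"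
  shows "toeplitz_op N W (\<lambda>x. \<Sum>i<N. c i * trig_exp N i x)
    = (\<lambda>x. \<Sum>j<N. (\<Sum>i<N. c i * of_real (band_coeff (int i - int j) W)) * trig_exp N j x)"
proof -
  let ?u = "\<lambda>x. \<Sum>i<N. c i * trig_exp N i x"
  have int: "set_integrable lebesgue {-w..w} (\<lambda>x. ?u x * cnj (trig_exp N j x))" for j w
    by (intro absolutely_integrable_continuous_real continuous_intros)
  have "trig_proj N ?u = ?u"
    using int [of "1/2"] by (subst trig_proj_eq) (auto simp: L2_inner_trig_sum unit_interval_def)
  moreover have "set_integrable lebesgue unit_interval
      (\<lambda>x. ?u x * indicator {-W..W} x * cnj (trig_exp N j x))" for j
  proof -
    have "(\<lambda>x. indicator unit_interval x *\<^sub>R (?u x * indicator {-W..W} x * cnj (trig_exp N j x)))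
        = (\<lambda>x. indicator {-W..W} x *\<^sub>R (?u x * cnj (trig_exp N j x)))"
      using W by (auto simp: fun_eq_iff unit_interval_def split: split_indicator)
    with int [of W j] show ?thesis by (simp add: set_integrable_def)
  qed
  ultimately show ?thesis
    unfolding toeplitz_op_def
    by (simp add: trig_proj_eq L2_inner_indicator [OF W(2)] band_inner_trig_sum [OF W(1)])
qed

section \<open>Spectral identities for the Slepian functions\<close>

text \<open>A Slepian system together with its matrix \<open>c\<close> of Fourier coefficients. The matrix is unitary
  and diagonalises the Toeplitz matrix, which reduces all spectral statements to finite sums.\<close>
locale slepian_basis =
  fixes N :: nat and W :: real and U :: "nat \<Rightarrow> real \<Rightarrow> complex" and ev :: "nat \<Rightarrow> real"
    and c :: "nat \<Rightarrow> nat \<Rightarrow> complex"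
  assumes W: "0 \<le> W" "W \<le> 1/2"
    and system: "slepian_system N W U ev"
    and expansion: "k < N \<Longrightarrow> U k = (\<lambda>x. \<Sum>j<N. c k j * trig_exp N j x)"
begin

lemma orthonormal: "j < N \<Longrightarrow> k < N \<Longrightarrow> L2_inner (U j) (U k) = (if j = k then 1 else 0)"
  using system by (simp add: slepian_system_def)

lemma ev_antimono: "j \<le> k \<Longrightarrow> k < N \<Longrightarrow> ev k \<le> ev j"
  using system by (simp add: slepian_system_def)

lemma continuous_on_U: "k < N \<Longrightarrow> continuous_on A (U k)"
  by (subst expansion) (auto intro!: continuous_intros)

lemma band_inner_U_right:
  assumes "k < N" "continuous_on UNIV g"
  shows "band_inner w g (U k) = (\<Sum>j<N. cnj (c k j) * band_inner w g (trig_exp N j))"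
  using assms by (simp add: expansion band_inner_sum_right continuous_on_trig_exp)

lemma coeff_rows:
  assumes "k < N"
  shows "(\<Sum>j<N. c k j * cnj (c k j)) = 1"
proof -
  have "(\<Sum>j<N. c k j * cnj (c k j)) = (\<Sum>j<N. cnj (c k j) * L2_inner (U k) (trig_exp N j))"
    using assms by (simp add: expansion L2_inner_trig_sum mult.commute)
  also have "\<dots> = L2_inner (U k) (U k)"
    using assms by (simp add: L2_inner_eq_band_inner band_inner_U_right continuous_on_U)
  finally show ?thesis using assms by (simp add: orthonormal)
qed

text \<open>The columns are orthonormal because the Slepian functions span: if an exponential is expanded in
  them, its coefficients are conjugated entries of \<open>c\<close>, and the inner product of two exponentials
  becomes the inner product of two columns.\<close>
lemma coeff_columns:
  assumes i: "i < N" and j: "j < N"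
  shows "(\<Sum>k<N. c k i * cnj (c k j)) = (if i = j then 1 else 0)"
proof -
  have L2_exp: "L2_inner (trig_exp N p) (trig_exp N q) = (if p = q then 1 else 0)" for p q
    by (simp add: L2_inner_eq_band_inner band_inner_trig_exp band_coeff_half)
  have "trig_exp N j \<in> complex_span N U"
    using system generator_in_complex_span [OF j, of "trig_exp N"]
    by (simp add: slepian_system_def trig_space_def)
  then obtain d where d: "trig_exp N j = (\<lambda>x. \<Sum>k<N. d k * U k x)"
    unfolding complex_span_def by blast
  have L2_exp_left: "L2_inner (trig_exp N j) g = (\<Sum>k<N. d k * L2_inner (U k) g)"
    if "continuous_on UNIV g" for g
    unfolding d L2_inner_eq_band_inner
    using that by (intro band_inner_sum_left) (auto intro: continuous_on_U)
  have "d k = cnj (c k j)" if k: "k < N" for k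
  proof -
    have "d k = L2_inner (trig_exp N j) (U k)"
      using k by (simp add: L2_exp_left continuous_on_U orthonormal if_distrib [of "\<lambda>x. _ * x"] cong: if_cong)
    also have "\<dots> = (\<Sum>l<N. cnj (c k l) * L2_inner (trig_exp N j) (trig_exp N l))"
      using k by (simp add: L2_inner_eq_band_inner band_inner_U_right continuous_on_trig_exp)
    also have "\<dots> = cnj (c k j)"
      using j by (simp add: L2_exp if_distrib [of "\<lambda>x. _ * x"] cong: if_cong)
    finally show ?thesis .
  qed
  moreover have "L2_inner (U k) (trig_exp N i) = c k i" if "k < N" for k
    using that i by (simp add: expansion L2_inner_trig_sum)
  ultimately have "L2_inner (trig_exp N j) (trig_exp N i) = (\<Sum>k<N. c k i * cnj (c k j))"
    by (simp add: L2_exp_left continuous_on_trig_exp mult.commute)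
  then show ?thesis by (auto simp: L2_exp)
qed

text \<open>Parseval's identity for the unitary matrix \<open>c\<close>. The pointwise identity for the density and
  both trace formulas below are instances of it.\<close>
lemma coeff_parseval:
  "(\<Sum>k<N. (\<Sum>i<N. c k i * v i) * cnj (\<Sum>i<N. c k i * w i)) = (\<Sum>i<N. v i * cnj (w i))"
proof -
  have "(\<Sum>k<N. (\<Sum>i<N. c k i * v i) * cnj (\<Sum>i<N. c k i * w i))
      = (\<Sum>k<N. \<Sum>i<N. \<Sum>j<N. v i * cnj (w j) * (c k i * cnj (c k j)))"
    by (simp add: sum_product mult_ac)
  also have "\<dots> = (\<Sum>i<N. \<Sum>j<N. v i * cnj (w j) * (\<Sum>k<N. c k i * cnj (c k j)))"
    by (subst sum.swap) (auto intro!: sum.cong sum.swap simp only: sum_distrib_left)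
  also have "\<dots> = (\<Sum>i<N. v i * cnj (w i))"
    by (simp add: coeff_columns if_distrib [of "\<lambda>x. _ * x"] cong: if_cong)
  finally show ?thesis .
qed

lemma eigen_equation:
  assumes "k < N" "j < N"
  shows "(\<Sum>i<N. c k i * of_real (band_coeff (int i - int j) W)) = of_real (ev k) * c k j"
proof -
  have "toeplitz_op N W (U k) = (\<lambda>x. of_real (ev k) * U k x)"
    using system assms by (simp add: slepian_system_def)
  then have "(\<lambda>x. \<Sum>j<N. (\<Sum>i<N. c k i * of_real (band_coeff (int i - int j) W)) * trig_exp N j x)
      = (\<lambda>x. \<Sum>j<N. (of_real (ev k) * c k j) * trig_exp N j x)"
    using assms W by (simp add: expansion toeplitz_op_trig_sum sum_distrib_left mult.assoc)
  from arg_cong [OF this, of "\<lambda>u. L2_inner u (trig_exp N j)"] show ?thesis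
    using assms by (simp add: L2_inner_trig_sum)
qed

text \<open>The reproducing kernel on the diagonal does not depend on the orthonormal basis, and for the
  exponentials it is plainly \<open>N\<close>.\<close>
lemma sum_cmod_sq_U: "(\<Sum>k<N. (cmod (U k x))\<^sup>2) = real N"
proof -
  have "complex_of_real (\<Sum>k<N. (cmod (U k x))\<^sup>2) = (\<Sum>i<N. trig_exp N i x * cnj (trig_exp N i x))"
    using coeff_parseval [of "\<lambda>i. trig_exp N i x" "\<lambda>i. trig_exp N i x"]
    by (simp add: complex_norm_square expansion del: of_real_power)
  also have "\<dots> = of_real (real N)"
    by (simp add: trig_exp_mult_cnj)
  finally show ?thesis by (simp only: of_real_eq_iff)
qed

lemma energy_in_band:
  assumes k: "k < N"
  shows "(LINT x:{-W..W}|lebesgue. (cmod (U k x))\<^sup>2) = ev k"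
proof -
  have "complex_of_real (LINT x:{-W..W}|lebesgue. (cmod (U k x))\<^sup>2) = band_inner W (U k) (U k)"
    by (simp add: band_inner_def set_integral_complex_of_real [symmetric] complex_norm_square
        del: of_real_power)
  also have "\<dots> = (\<Sum>j<N. cnj (c k j) * band_inner W (U k) (trig_exp N j))"
    using k by (simp add: band_inner_U_right continuous_on_U)
  also have "\<dots> = (\<Sum>j<N. of_real (ev k) * (c k j * cnj (c k j)))"
    using k by (intro sum.cong) (auto simp: expansion band_inner_trig_sum [OF W(1)] eigen_equation)
  also have "\<dots> = of_real (ev k)"
    using k by (simp add: sum_distrib_left [symmetric] coeff_rows)
  finally show ?thesis by simp
qed

lemma energy_total:
  assumes "k < N"
  shows "(LINT x:unit_interval|lebesgue. (cmod (U k x))\<^sup>2) = 1"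
proof -
  have "complex_of_real (LINT x:unit_interval|lebesgue. (cmod (U k x))\<^sup>2) = L2_inner (U k) (U k)"
    by (simp add: L2_inner_def set_integral_complex_of_real [symmetric] complex_norm_square
        del: of_real_power)
  also have "\<dots> = 1" using assms by (simp add: orthonormal)
  finally show ?thesis by simp
qed

lemma set_integrable_cmod_sq_U:
  "k < N \<Longrightarrow> set_integrable lebesgue {a..b} (\<lambda>x. (cmod (U k x))\<^sup>2)"
  by (intro absolutely_integrable_continuous_real continuous_intros continuous_on_U)

lemma ev_bounds:
  assumes k: "k < N"
  shows "0 \<le> ev k" "ev k \<le> 1"
proof -
  show "0 \<le> ev k"
    unfolding energy_in_band [OF k, symmetric] set_lebesgue_integral_def
    by (intro integral_nonneg_AE) auto
  have "(LINT x:{-W..W}|lebesgue. (cmod (U k x))\<^sup>2) \<le> (LINT x:unit_interval|lebesgue. (cmod (U k x))\<^sup>2)"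
    unfolding set_lebesgue_integral_def
    by (rule integral_mono)
       (use k W set_integrable_cmod_sq_U in \<open>auto simp: set_integrable_def unit_interval_def split: split_indicator\<close>)
  then show "ev k \<le> 1"
    using k by (simp add: energy_in_band energy_total)
qed

text \<open>The trace of the Toeplitz matrix. Writing \<open>c k j\<close> as the inner product of row \<open>k\<close> with the
  \<open>j\<close>th unit vector puts the sum into the form of \<open>coeff_parseval\<close>.\<close>
lemma sum_ev: "(\<Sum>k<N. ev k) = 2 * real N * W"
proof -
  have "(\<Sum>k<N. complex_of_real (ev k)) = (\<Sum>k<N. \<Sum>j<N. of_real (ev k) * (c k j * cnj (c k j)))"
    by (simp add: sum_distrib_left [symmetric] coeff_rows)
  also have "\<dots> = (\<Sum>j<N. \<Sum>k<N. (\<Sum>i<N. c k i * of_real (band_coeff (int i - int j) W))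
      * cnj (\<Sum>i<N. c k i * (if i = j then 1 else 0)))"
    by (subst sum.swap)
       (auto intro!: sum.cong simp: eigen_equation if_distrib [of "\<lambda>x. _ * x"] cong: if_cong)
  also have "\<dots> = (\<Sum>j<N. of_real (band_coeff 0 W))"
    unfolding coeff_parseval by (auto simp: if_distrib [of "\<lambda>x. _ * x"] if_distrib [of cnj] cong: if_cong)
  finally have "complex_of_real (\<Sum>k<N. ev k) = of_real (2 * real N * W)"
    by (simp add: band_coeff_def)
  then show ?thesis by (simp only: of_real_eq_iff)
qed

text \<open>The squared Hilbert-Schmidt norm of the Toeplitz matrix.\<close>
lemma sum_ev_sq: "(\<Sum>k<N. (ev k)\<^sup>2) = (\<Sum>i<N. \<Sum>j<N. (band_coeff (int i - int j) W)\<^sup>2)"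
proof -
  have "(\<Sum>k<N. complex_of_real ((ev k)\<^sup>2)) = (\<Sum>k<N. \<Sum>j<N. of_real ((ev k)\<^sup>2) * (c k j * cnj (c k j)))"
    by (simp add: sum_distrib_left [symmetric] coeff_rows)
  also have "\<dots> = (\<Sum>j<N. \<Sum>k<N. (\<Sum>i<N. c k i * of_real (band_coeff (int i - int j) W))
      * cnj (\<Sum>i<N. c k i * of_real (band_coeff (int i - int j) W)))"
    by (subst sum.swap) (auto intro!: sum.cong simp: eigen_equation power2_eq_square)
  also have "\<dots> = (\<Sum>j<N. \<Sum>i<N. of_real ((band_coeff (int i - int j) W)\<^sup>2))"
    unfolding coeff_parseval by (simp add: power2_eq_square)
  finally have "complex_of_real (\<Sum>k<N. (ev k)\<^sup>2)
      = of_real (\<Sum>j<N. \<Sum>i<N. (band_coeff (int i - int j) W)\<^sup>2)"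
    by simp
  then show ?thesis by (simp only: of_real_eq_iff) (rule sum.swap)
qed

lemma sum_ev_deviation: "(\<Sum>k<N. ev k * (1 - ev k)) = band_leakage N W"
  unfolding band_leakage_def sum_ev [symmetric] sum_ev_sq [symmetric]
  by (simp add: right_diff_distrib sum_subtractf power2_eq_square)

lemma slepian_density_le:
  assumes "K \<le> N"
  shows "slepian_density U K x \<le> real N"
  unfolding slepian_density_def sum_cmod_sq_U [of x, symmetric]
  using assms by (intro sum_mono2) auto

lemma set_integral_slepian_density:
  assumes "K \<le> N"
  shows "set_integrable lebesgue {a..b} (slepian_density U K)"
    and "(LINT x:{-W..W}|lebesgue. slepian_density U K x) = (\<Sum>k<K. ev k)"
    and "(LINT x:unit_interval|lebesgue. slepian_density U K x) = real K"
proof -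
  have K: "k < N" if "k < K" for k using that assms by simp
  show "set_integrable lebesgue {a..b} (slepian_density U K)"
    unfolding slepian_density_def
    by (intro absolutely_integrable_continuous_real continuous_intros continuous_on_U) (simp add: K)
  show "(LINT x:{-W..W}|lebesgue. slepian_density U K x) = (\<Sum>k<K. ev k)"
    unfolding slepian_density_def
    by (subst set_integral_sum) (auto simp: K set_integrable_cmod_sq_U energy_in_band)
  show "(LINT x:unit_interval|lebesgue. slepian_density U K x) = real K"
    unfolding slepian_density_def
    by (subst set_integral_sum)
       (auto simp: K energy_total set_integrable_cmod_sq_U [of _ "-1/2" "1/2", folded unit_interval_def])
qed

text \<open>Inside the band both \<open>\<rho> / K\<close> and \<open>1 / (2 * W)\<close> are at most \<open>N / K\<close>, so their distance is at
  most the sum of their distances to \<open>N / K\<close>; outside, the error is \<open>\<rho> / K\<close> itself. This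
  majorant contains no absolute values, and its integral only involves the total mass \<open>K\<close> of
  \<open>\<rho>\<close> and its mass \<open>\<Sum>k<K. ev k\<close> in the band.\<close>
lemma L1_error_le:
  assumes K: "0 < K" "real K \<le> 2 * real N * W" and "0 < W"
  shows "L1_norm (\<lambda>x. 1 / real K * slepian_density U K x - 1 / (2 * W) * indicator {-W..W} x)
    \<le> (4 * real N * W - 2 * (\<Sum>k<K. ev k)) / real K"
proof -
  let ?\<rho> = "slepian_density U K" and ?I = "unit_interval"
  have "2 * real N * W \<le> real N"
    using mult_left_mono [OF W(2), of "2 * real N"] by simp
  with K have KN: "K \<le> N" by linarith
  \<comment> \<open>The majorant is \<open>\<rho> / K\<close> everywhere plus \<open>g\<close> on the band.\<close>
  define g where "g x = 2 * real N / K - 1 / (2 * W) - 2 / K * ?\<rho> x" for x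
  have int_rho: "set_integrable lebesgue {a..b} ?\<rho>" for a b
    by (rule set_integral_slepian_density(1) [OF KN])
  have int_const: "set_integrable lebesgue {a..b} (\<lambda>x. r)" for a b r :: real
    by (intro absolutely_integrable_continuous_real continuous_intros)
  have int_g: "set_integrable lebesgue {a..b} g" for a b
    unfolding g_def using int_rho [of a b] int_const [of a b] by auto
  have restrict: "(\<lambda>x. indicator ?I x *\<^sub>R (f x * indicator {-W..W} x))
      = (\<lambda>x. indicator {-W..W} x *\<^sub>R f x)" for f :: "real \<Rightarrow> real"
    using W by (auto simp: fun_eq_iff unit_interval_def split: split_indicator)
  have int_band: "set_integrable lebesgue ?I (\<lambda>x. f x * indicator {-W..W} x)"
    if "set_integrable lebesgue {-W..W} f" for f :: "real \<Rightarrow> real"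
    using that unfolding set_integrable_def restrict .
  have int_rho_I: "set_integrable lebesgue ?I (\<lambda>x. 1 / real K * ?\<rho> x)"
    using int_rho [of "-1/2" "1/2"] unfolding unit_interval_def by simp
  have "L1_norm (\<lambda>x. 1 / real K * ?\<rho> x - 1 / (2 * W) * indicator {-W..W} x)
      \<le> (LINT x:?I|lebesgue. 1 / real K * ?\<rho> x + g x * indicator {-W..W} x)"
    unfolding L1_norm_def
  proof (rule set_integral_mono)
    show "set_integrable lebesgue ?I
        (\<lambda>x. \<bar>1 / real K * ?\<rho> x - 1 / (2 * W) * indicator {-W..W} x\<bar>)"
      by (intro set_integrable_abs set_integral_diff(1) int_rho_I int_band int_const)
    show "set_integrable lebesgue ?I (\<lambda>x. 1 / real K * ?\<rho> x + g x * indicator {-W..W} x)"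
      by (intro set_integral_add(1) int_rho_I int_band int_g)
    fix x
    have rho: "0 \<le> ?\<rho> x" "?\<rho> x / K \<le> real N / K"
      using slepian_density_le [OF KN, of x]
      by (auto simp: slepian_density_def sum_nonneg divide_right_mono)
    have "1 / (2 * W) \<le> real N / K"
      using K \<open>0 < W\<close> by (simp add: field_simps)
    then have "\<bar>?\<rho> x / K - 1 / (2 * W)\<bar> \<le> ?\<rho> x / K + g x"
      unfolding g_def using rho by (simp add: abs_le_iff)
    then show "\<bar>1 / real K * ?\<rho> x - 1 / (2 * W) * indicator {-W..W} x\<bar>
        \<le> 1 / real K * ?\<rho> x + g x * indicator {-W..W} x"
      using rho(1) by (simp add: indicator_def)
  qed
  also have "\<dots> = (LINT x:?I|lebesgue. 1 / real K * ?\<rho> x) + (LINT x:?I|lebesgue. g x * indicator {-W..W} x)"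
    by (intro set_integral_add(2) int_rho_I int_band int_g)
  also have "(LINT x:?I|lebesgue. 1 / real K * ?\<rho> x) = 1"
    using K by (simp add: set_integral_slepian_density(3) [OF KN])
  also have "(LINT x:?I|lebesgue. g x * indicator {-W..W} x) = (LINT x:{-W..W}|lebesgue. g x)"
    unfolding set_lebesgue_integral_def restrict ..
  also have "\<dots> = 2 * W * (2 * real N / K - 1 / (2 * W)) - 2 / K * (\<Sum>k<K. ev k)"
  proof -
    have "(LINT x:{-W..W}|lebesgue. g x)
        = (LINT x:{-W..W}|lebesgue. 2 * real N / K - 1 / (2 * W)) - (LINT x:{-W..W}|lebesgue. 2 / K * ?\<rho> x)"
      unfolding g_def by (rule set_integral_diff(2)) (use int_rho int_const in auto)
    moreover have "(LINT x:{-W..W}|lebesgue. r) = 2 * W * r" for r :: real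
      using W by (simp add: set_lebesgue_integral_def)
    ultimately show ?thesis
      by (simp add: set_integral_slepian_density(2) [OF KN])
  qed
  also have "1 + \<dots> = (4 * real N * W - 2 * (\<Sum>k<K. ev k)) / real K"
    using K \<open>0 < W\<close> by (simp add: field_simps)
  finally show ?thesis by simp
qed

end

lemma slepian_basis_exists:
  assumes "0 \<le> W" "W \<le> 1/2" and S: "slepian_system N W U ev"
  obtains c where "slepian_basis N W U ev c"
proof -
  have "\<exists>d. U k = (\<lambda>x. \<Sum>j<N. d j * trig_exp N j x)" if "k < N" for k
    using generator_in_complex_span [OF that, of U] S
    by (simp add: slepian_system_def trig_space_def) (simp add: complex_span_def)
  then obtain c where "\<And>k. k < N \<Longrightarrow> U k = (\<lambda>x. \<Sum>j<N. c k j * trig_exp N j x)"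
    by metis
  then show ?thesis
    using assms by (intro that [of c]) (simp add: slepian_basis_def)
qed

section \<open>From the leakage to the first eigenvalues\<close>

text \<open>Let \<open>a\<close> cross \<open>1/2\<close> somewhere. If this happens from \<open>K\<close> on, every \<open>1 - a k\<close> with \<open>k < K\<close> is
  at most \<open>2 * a k * (1 - a k)\<close>. If it happens before \<open>K\<close>, every \<open>a k\<close> with \<open>k \<ge> K\<close> obeys the same
  bound, and by the lower bound on the total sum these terms outweigh the deficit of the first \<open>K\<close>
  ones.\<close>
lemma sum_complement_le_twice_deviation:
  fixes a :: "nat \<Rightarrow> real"
  assumes anti: "\<And>j k. j \<le> k \<Longrightarrow> k < N \<Longrightarrow> a k \<le> a j"
    and bounds: "\<And>k. k < N \<Longrightarrow> 0 \<le> a k \<and> a k \<le> 1"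
    and K: "K \<le> N" "real K \<le> (\<Sum>k<N. a k)"
  shows "(\<Sum>k<K. 1 - a k) \<le> 2 * (\<Sum>k<N. a k * (1 - a k))"
proof -
  have nonneg: "0 \<le> (\<Sum>k\<in>A. a k * (1 - a k))" if "A \<subseteq> {..<N}" for A
    using bounds that by (intro sum_nonneg) (auto simp: subset_iff)
  have split: "(\<Sum>k<N. f k) = (\<Sum>k<K. f k) + (\<Sum>k=K..<N. f k)" for f :: "nat \<Rightarrow> real"
    using K sum.atLeastLessThan_concat [of 0 K N f] by (simp add: atLeast0LessThan)
  show ?thesis
  proof (cases "\<forall>k<K. 1/2 \<le> a k")
    case True
    have "(\<Sum>k<K. 1 - a k) \<le> (\<Sum>k<K. 2 * (a k * (1 - a k)))"
    proof (rule sum_mono)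
      fix k assume "k \<in> {..<K}"
      then have "1/2 \<le> a k" "a k \<le> 1" using True K bounds by auto
      then have "0 \<le> (2 * a k - 1) * (1 - a k)" by simp
      then show "1 - a k \<le> 2 * (a k * (1 - a k))" by (simp add: algebra_simps)
    qed
    also have "\<dots> \<le> 2 * (\<Sum>k<N. a k * (1 - a k))"
      unfolding split using nonneg [of "{K..<N}"] by (simp add: sum_distrib_left [symmetric] subset_iff)
    finally show ?thesis .
  next
    case False
    then obtain j where j: "j < K" "a j < 1/2" by auto
    have "(\<Sum>k<K. 1 - a k) \<le> (\<Sum>k=K..<N. a k)"
      using K split [of a] by (simp add: sum_subtractf)
    also have "\<dots> \<le> (\<Sum>k=K..<N. 2 * (a k * (1 - a k)))"
    proof (rule sum_mono)
      fix k assume k: "k \<in> {K..<N}"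
      then have "a k \<le> 1/2" "0 \<le> a k" using anti [of j k] j bounds by auto
      then have "0 \<le> a k * (1 - 2 * a k)" by simp
      then show "a k \<le> 2 * (a k * (1 - a k))" by (simp add: algebra_simps)
    qed
    also have "\<dots> \<le> 2 * (\<Sum>k<N. a k * (1 - a k))"
      unfolding split using nonneg [of "{..<K}"] K by (simp add: sum_distrib_left [symmetric])
    finally show ?thesis .
  qed
qed

theorem theorem1:
  "\<exists>C::real. C > 0 \<and>
     (\<forall>(N::nat) (W::real) (K::nat) (U :: nat \<Rightarrow> real \<Rightarrow> complex) (ev :: nat \<Rightarrow> real).
        N \<ge> 2 \<longrightarrow> 1 / (2 * real N) < W \<longrightarrow> W < 1/2 \<longrightarrow>
        K = nat \<lfloor>2 * real N * W\<rfloor> \<longrightarrow>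
        slepian_system N W U ev \<longrightarrow>
        L1_norm (\<lambda>x. 1 / real K * slepian_density U K x - 1 / (2 * W) * indicator {-W..W} x)
          \<le> C * (ln (real N) / real K))"
proof (intro exI [of _ 14] conjI allI impI)
  fix N K :: nat and W :: real and U :: "nat \<Rightarrow> real \<Rightarrow> complex" and ev :: "nat \<Rightarrow> real"
  assume N: "2 \<le> N" and width: "1 / (2 * real N) < W" "W < 1/2"
    and K: "K = nat \<lfloor>2 * real N * W\<rfloor>" and S: "slepian_system N W U ev"
  have "0 < W" using width(1) by (rule le_less_trans [rotated]) simp
  then obtain c where "slepian_basis N W U ev c"
    using slepian_basis_exists [OF _ _ S] width(2) by auto
  then interpret slepian_basis N W U ev c .
  have one: "1 < 2 * real N * W" using width(1) N by (simp add: field_simps)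
  have K_bounds: "0 < K" "real K \<le> 2 * real N * W" "2 * real N * W < real K + 1"
    using one unfolding K by linarith+
  have "2 * real N * W \<le> real N"
    using mult_left_mono [of W "1/2" "2 * real N"] width(2) by simp
  with K_bounds have KN: "K \<le> N" by linarith
  have "(\<Sum>k<K. 1 - ev k) \<le> 2 * (\<Sum>k<N. ev k * (1 - ev k))"
    using ev_antimono ev_bounds KN K_bounds
    by (intro sum_complement_le_twice_deviation) (auto simp: sum_ev)
  also have "\<dots> \<le> 2 + ln (real N)"
    using band_leakage_log_bound [of N W] N width by (simp add: sum_ev_deviation)
  finally have "real K - (\<Sum>k<K. ev k) \<le> 2 + ln (real N)"
    by (simp add: sum_subtractf)
  moreover have "1/2 \<le> ln (real N)"
  proof -
    have "1/2 \<le> ln (2::real)" using ln_le_minus_one [of "1/2::real"] by (simp add: ln_div)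
    also have "\<dots> \<le> ln (real N)" using N by simp
    finally show ?thesis .
  qed
  \<comment> \<open>The left side is at most \<open>2 + 2 * (2 + ln N)\<close>, and \<open>6 \<le> 12 * ln N\<close>; hence the constant \<open>14\<close>.\<close>
  ultimately have "4 * real N * W - 2 * (\<Sum>k<K. ev k) \<le> 14 * ln (real N)"
    using K_bounds by linarith
  then have "(4 * real N * W - 2 * (\<Sum>k<K. ev k)) / real K \<le> 14 * (ln (real N) / real K)"
    by (simp add: divide_right_mono)
  with L1_error_le [OF K_bounds(1,2) \<open>0 < W\<close>]
  show "L1_norm (\<lambda>x. 1 / real K * slepian_density U K x - 1 / (2 * W) * indicator {-W..W} x)
      \<le> 14 * (ln (real N) / real K)"
    by linarith
qed simp

end
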